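(* For every resolute social choice function $f:\mathcal L(A)^N\to A$ (with $N,A$ finite): (i) $f$ is strategy-proof iff $\mathfrak M_f,(R,R)\models\bigwedge_{i\in N}\neg\mu_{\{i\}}$ for every $R\in\mathcal L(A)^N$; (ii) $f$ is strongly group strategy-proof iff $\mathfrak M_f,(R,R)\models\bigwedge_{\varnothing\ne C\subseteq N}\neg\mu_C$ for every $R\in\mathcal L(A)^N$.
   Context: $\mathcal L(A)$ strict linear orders on $A$; $x\succ_i^R y$ means $x$ above $y$ in $R_i$, $x\succeq_i^R y$ means $x=y$ or $x\succ_i^Ry$; $Q\equiv_{-C}P$ means $Q_j=P_j$ for $j\notin C$. $f$ is strategy-proof if for all $R$, $i$, and $Q_i\in\mathcal L(A)$, $f(R)\succeq_i^R f(Q_i,R_{-i})$. $f$ is strongly group strategy-proof if there are no non-empty $C$, profile $R$, and $Q\equiv_{-C}R$ with $f(Q)\succeq_i^Rf(R)$ for all $i\in C$ and $f(Q)\succ_j^R f(R)$ for some $j\in C$. Biprofile model $\mathfrak M_f$: states $(R,P)$; $(R,P)E_C(R',Q)$ iff $R'=R$ and $Q\equiv_{-C}P$; $o_x$ true at $(R,P)$ iff $f(P)=x$; $p^i_{xy}$ true iff $x\succ_i^Ry$; $\langle C\rangle$ is the diamond of $E_C$. $\mathrm{Imp}_C(y,x)=\bigwedge_{i\in C}((y=x)\vee p^i_{yx})\wedge\bigvee_{i\in C}p^i_{yx}$; $\mu_C=\bigvee_{x,y\in A}(o_x\wedge\mathrm{Imp}_C(y,x)\wedge\langle C\rangle o_y)$.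 *)

theory Defs
  imports Main "HOL-Library.FuncSet"
begin

text \<open>\<open>(x, y) \<in> r\<close> means that \<open>x\<close> is ranked above \<open>y\<close>. The inclusion in \<open>A \<times> A\<close> is needed
  because \<open>strict_linear_order_on\<close> does not require it.\<close>

definition strict_rankings :: "'a set \<Rightarrow> 'a rel set" where
  "strict_rankings A = {r. r \<subseteq> A \<times> A \<and> strict_linear_order_on A r}"

type_synonym ('i, 'a) profile = "'i \<Rightarrow> 'a rel"

definition profiles :: "'i set \<Rightarrow> 'a set \<Rightarrow> ('i, 'a) profile set" where
  "profiles N A = N \<rightarrow>\<^sub>E strict_rankings A"

definition prefers :: "('i, 'a) profile \<Rightarrow> 'i \<Rightarrow> 'a \<Rightarrow> 'a \<Rightarrow> bool" where
  "prefers R i x y \<longleftrightarrow> (x, y) \<in> R i"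

definition weakly_prefers :: "('i, 'a) profile \<Rightarrow> 'i \<Rightarrow> 'a \<Rightarrow> 'a \<Rightarrow> bool" where
  "weakly_prefers R i x y \<longleftrightarrow> x = y \<or> prefers R i x y"

definition agree_outside ::
  "'i set \<Rightarrow> 'i set \<Rightarrow> ('i, 'a) profile \<Rightarrow> ('i, 'a) profile \<Rightarrow> bool" where
  "agree_outside N C Q P \<longleftrightarrow> (\<forall>j\<in>N - C. Q j = P j)"

definition resolute_scf :: "'i set \<Rightarrow> 'a set \<Rightarrow> (('i, 'a) profile \<Rightarrow> 'a) \<Rightarrow> bool" where
  "resolute_scf N A f \<longleftrightarrow> f \<in> profiles N A \<rightarrow> A"

definition strategy_proof :: "'i set \<Rightarrow> 'a set \<Rightarrow> (('i, 'a) profile \<Rightarrow> 'a) \<Rightarrow> bool" where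
  "strategy_proof N A f \<longleftrightarrow>
    (\<forall>R\<in>profiles N A. \<forall>i\<in>N. \<forall>q\<in>strict_rankings A. weakly_prefers R i (f R) (f (R(i := q))))"

definition strongly_group_strategy_proof ::
  "'i set \<Rightarrow> 'a set \<Rightarrow> (('i, 'a) profile \<Rightarrow> 'a) \<Rightarrow> bool" where
  "strongly_group_strategy_proof N A f \<longleftrightarrow>
    \<not> (\<exists>C R Q. C \<noteq> {} \<and> C \<subseteq> N \<and> R \<in> profiles N A \<and> Q \<in> profiles N A \<and>
        agree_outside N C Q R \<and>
        (\<forall>i\<in>C. weakly_prefers R i (f Q) (f R)) \<and> (\<exists>j\<in>C. prefers R j (f Q) (f R)))"

text \<open>\<open>'p\<close> are the propositional atoms, \<open>'m\<close> the labels of the diamonds.\<close>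

datatype ('p, 'm) fm =
    Atom 'p
  | Bot
  | Neg "('p, 'm) fm"
  | And "('p, 'm) fm" "('p, 'm) fm"
  | Or "('p, 'm) fm" "('p, 'm) fm"
  | Dia 'm "('p, 'm) fm"

abbreviation Top :: "('p, 'm) fm" where
  "Top \<equiv> Neg Bot"

record ('w, 'p, 'm) kripke =
  worlds :: "'w set"
  acc :: "'m \<Rightarrow> 'w rel"
  val :: "'w \<Rightarrow> 'p \<Rightarrow> bool"

primrec sat :: "('w, 'p, 'm) kripke \<Rightarrow> 'w \<Rightarrow> ('p, 'm) fm \<Rightarrow> bool" where
  "sat M w (Atom p) \<longleftrightarrow> val M w p"
| "sat M w Bot \<longleftrightarrow> False"
| "sat M w (Neg \<phi>) \<longleftrightarrow> \<not> sat M w \<phi>"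
| "sat M w (And \<phi> \<psi>) \<longleftrightarrow> sat M w \<phi> \<and> sat M w \<psi>"
| "sat M w (Or \<phi> \<psi>) \<longleftrightarrow> sat M w \<phi> \<or> sat M w \<psi>"
| "sat M w (Dia m \<phi>) \<longleftrightarrow> (\<exists>v\<in>worlds M. (w, v) \<in> acc M m \<and> sat M v \<phi>)"

text \<open>Conjunctions and disjunctions over a finite index set are iterated binary ones along an
  arbitrary enumeration of the index set. They are meaningful for finite index sets only.\<close>

definition enumeration :: "'b set \<Rightarrow> 'b list" where
  "enumeration S = (SOME xs. distinct xs \<and> set xs = S)"

definition big_and :: "'b set \<Rightarrow> ('b \<Rightarrow> ('p, 'm) fm) \<Rightarrow> ('p, 'm) fm" where
  "big_and S \<phi> = foldr (\<lambda>s. And (\<phi> s)) (enumeration S) Top"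

definition big_or :: "'b set \<Rightarrow> ('b \<Rightarrow> ('p, 'm) fm) \<Rightarrow> ('p, 'm) fm" where
  "big_or S \<phi> = foldr (\<lambda>s. Or (\<phi> s)) (enumeration S) Bot"

lemma set_enumeration:
  assumes "finite S"
  shows "set (enumeration S) = S"
proof -
  have "\<exists>xs. distinct xs \<and> set xs = S"
    using finite_distinct_list[OF assms] by blast
  then show ?thesis
    unfolding enumeration_def by (rule someI2_ex) simp
qed

lemma sat_big_and:
  assumes "finite S"
  shows "sat M w (big_and S \<phi>) \<longleftrightarrow> (\<forall>s\<in>S. sat M w (\<phi> s))"
proof -
  have "sat M w (foldr (\<lambda>s. And (\<phi> s)) xs Top) \<longleftrightarrow> (\<forall>s\<in>set xs. sat M w (\<phi> s))" for xs
    by (induction xs) auto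
  then show ?thesis
    by (simp add: big_and_def set_enumeration[OF assms])
qed

lemma sat_big_or:
  assumes "finite S"
  shows "sat M w (big_or S \<phi>) \<longleftrightarrow> (\<exists>s\<in>S. sat M w (\<phi> s))"
proof -
  have "sat M w (foldr (\<lambda>s. Or (\<phi> s)) xs Bot) \<longleftrightarrow> (\<exists>s\<in>set xs. sat M w (\<phi> s))" for xs
    by (induction xs) auto
  then show ?thesis
    by (simp add: big_or_def set_enumeration[OF assms])
qed

datatype ('i, 'a) atom = Outcome 'a | Pref 'i 'a 'a

type_synonym ('i, 'a) bifm = "(('i, 'a) atom, 'i set) fm"

text \<open>In a state \<open>(R, P)\<close>, the profile \<open>R\<close> carries the true preferences and \<open>P\<close> the reported ones.\<close>

fun biprofile_val ::
  "(('i, 'a) profile \<Rightarrow> 'a) \<Rightarrow> ('i, 'a) profile \<times> ('i, 'a) profile \<Rightarrow> ('i, 'a) atom \<Rightarrow> bool" where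
  "biprofile_val f (R, P) (Outcome x) \<longleftrightarrow> f P = x"
| "biprofile_val f (R, P) (Pref i x y) \<longleftrightarrow> prefers R i x y"

definition biprofile_model ::
  "'i set \<Rightarrow> 'a set \<Rightarrow> (('i, 'a) profile \<Rightarrow> 'a) \<Rightarrow>
    (('i, 'a) profile \<times> ('i, 'a) profile, ('i, 'a) atom, 'i set) kripke" where
  "biprofile_model N A f =
    \<lparr> worlds = profiles N A \<times> profiles N A,
      acc = (\<lambda>C. {((R, P), (R', Q)).
        (R, P) \<in> profiles N A \<times> profiles N A \<and> (R', Q) \<in> profiles N A \<times> profiles N A \<and>
        R' = R \<and> agree_outside N C Q P}),
      val = biprofile_val f \<rparr>"

text \<open>The disjunct \<open>y = x\<close> is not an atom: for each given pair of alternatives it is the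
  corresponding truth constant.\<close>

definition eq_fm :: "'a \<Rightarrow> 'a \<Rightarrow> ('p, 'm) fm" where
  "eq_fm y x = (if y = x then Top else Bot)"

definition Imp :: "'i set \<Rightarrow> 'a \<Rightarrow> 'a \<Rightarrow> ('i, 'a) bifm" where
  "Imp C y x =
    And (big_and C (\<lambda>i. Or (eq_fm y x) (Atom (Pref i y x))))
        (big_or C (\<lambda>i. Atom (Pref i y x)))"

definition manip :: "'a set \<Rightarrow> 'i set \<Rightarrow> ('i, 'a) bifm" where
  "manip A C =
    big_or (A \<times> A)
      (\<lambda>(x, y). And (And (Atom (Outcome x)) (Imp C y x)) (Dia C (Atom (Outcome y))))"

end

theory Submission
  imports Defs
begin

text \<open>
  Both parts rest on reading the formula \<open>\<mu>\<^sub>C\<close> at a diagonal state as the existence of a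
  report by \<open>C\<close> that improves on the outcome for \<open>C\<close>. For singletons it remains
  to note that, rankings being linear, the truthful outcome is weakly preferred iff
  the deviating outcome is not strictly preferred.
\<close>

text \<open>Totality gives the direction from right to left. The converse is irreflexivity if
  \<open>x = y\<close>, and otherwise asymmetry, from transitivity and irreflexivity.\<close>

lemma weakly_prefers_iff_not_prefers:
  assumes "R i \<in> strict_rankings A" "x \<in> A" "y \<in> A"
  shows "weakly_prefers R i x y \<longleftrightarrow> \<not> prefers R i y x"
  using assms
  by (auto simp: weakly_prefers_def prefers_def strict_rankings_def strict_linear_order_on_def
      total_on_def irrefl_def dest: transD)

lemma profiles_fun_upd:
  assumes "R \<in> profiles N A" "i \<in> N" "q \<in> strict_rankings A"
  shows "R(i := q) \<in> profiles N A"
  using assms by (auto simp: profiles_def PiE_iff extensional_def)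

text \<open>Bridges the update form of a deviation in \<open>strategy_proof\<close> and the
  accessibility relation of the coalition \<open>{i}\<close>.\<close>

lemma agree_outside_singleton_iff:
  assumes "Q \<in> profiles N A" "R \<in> profiles N A" "i \<in> N"
  shows "agree_outside N {i} Q R \<longleftrightarrow> (\<exists>q\<in>strict_rankings A. Q = R(i := q))"
proof
  assume agree: "agree_outside N {i} Q R"
  \<comment> \<open>Off \<open>N\<close> both sides are \<open>undefined\<close>, since profiles are
    extensional; so agreement on \<open>N - {i}\<close> suffices for equality of functions.\<close>
  have "Q = R(i := Q i)"
  proof
    fix j
    show "Q j = (R(i := Q i)) j"
      using agree assms by (cases "j \<in> N") (auto simp: agree_outside_def profiles_def PiE_iff extensional_def)
  qed
  moreover have "Q i \<in> strict_rankings A"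
    using assms by (auto simp: profiles_def)
  ultimately show "\<exists>q\<in>strict_rankings A. Q = R(i := q)"
    by blast
qed (auto simp: agree_outside_def)

lemma sat_Imp:
  assumes "finite C"
  shows "sat (biprofile_model N A f) (R, P) (Imp C y x) \<longleftrightarrow>
    (\<forall>i\<in>C. weakly_prefers R i y x) \<and> (\<exists>i\<in>C. prefers R i y x)"
  by (auto simp: Imp_def sat_big_and[OF assms] sat_big_or[OF assms] eq_fm_def weakly_prefers_def
      biprofile_model_def)

text \<open>The disjunction over pairs only names outcomes: \<open>x\<close> must be
  \<open>f P\<close>, and \<open>y\<close> must be \<open>f Q\<close> for the state
  \<open>(R, Q)\<close> reached by the diamond. Both lie in \<open>A\<close>, so no case is
  lost.\<close>

lemma sat_manip:
  assumes "finite A" "finite C" "resolute_scf N A f" "R \<in> profiles N A" "P \<in> profiles N A"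
  shows "sat (biprofile_model N A f) (R, P) (manip A C) \<longleftrightarrow>
    (\<exists>Q\<in>profiles N A. agree_outside N C Q P \<and>
      (\<forall>i\<in>C. weakly_prefers R i (f Q) (f P)) \<and> (\<exists>i\<in>C. prefers R i (f Q) (f P)))"
proof -
  have val: "val (biprofile_model N A f) = biprofile_val f"
    by (simp add: biprofile_model_def)
  have dia: "sat (biprofile_model N A f) (R, P) (Dia C (Atom (Outcome y))) \<longleftrightarrow>
      (\<exists>Q\<in>profiles N A. agree_outside N C Q P \<and> f Q = y)" for y
    using assms(4,5) by (auto simp: biprofile_model_def)
  have f: "f Q \<in> A" if "Q \<in> profiles N A" for Q
    using assms(3) that by (auto simp: resolute_scf_def)
  \<comment> \<open>The semantic clause for diamonds is withheld from the simplifier so that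
    \<open>dia\<close> rewrites them instead.\<close>
  have "sat (biprofile_model N A f) (R, P) (manip A C) \<longleftrightarrow>
      (\<exists>x\<in>A. \<exists>y\<in>A. f P = x \<and>
        ((\<forall>i\<in>C. weakly_prefers R i y x) \<and> (\<exists>i\<in>C. prefers R i y x)) \<and>
        (\<exists>Q\<in>profiles N A. agree_outside N C Q P \<and> f Q = y))"
    using assms(1)
    by (auto simp: manip_def sat_big_or sat_Imp[OF assms(2)] dia val simp del: sat.simps(6))
  then show ?thesis
    using f assms(5) by blast
qed

theorem theorem2:
  fixes N :: "'i set" and A :: "'a set" and f :: "('i, 'a) profile \<Rightarrow> 'a"
  assumes "finite N" and "finite A" and "resolute_scf N A f"
  shows "(strategy_proof N A f \<longleftrightarrow>
            (\<forall>R\<in>profiles N A.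
              sat (biprofile_model N A f) (R, R) (big_and N (\<lambda>i. Neg (manip A {i}))))) \<and>
         (strongly_group_strategy_proof N A f \<longleftrightarrow>
            (\<forall>R\<in>profiles N A.
              sat (biprofile_model N A f) (R, R)
                (big_and {C. C \<noteq> {} \<and> C \<subseteq> N} (\<lambda>C. Neg (manip A C)))))"
proof
  have f: "f Q \<in> A" if "Q \<in> profiles N A" for Q
    using assms(3) that by (auto simp: resolute_scf_def)
  have "(\<forall>q\<in>strict_rankings A. weakly_prefers R i (f R) (f (R(i := q)))) \<longleftrightarrow>
      \<not> sat (biprofile_model N A f) (R, R) (manip A {i})"
    if R: "R \<in> profiles N A" and i: "i \<in> N" for R i
  proof -
    have "R i \<in> strict_rankings A"
      using R i by (auto simp: profiles_def)
    then have "(\<forall>q\<in>strict_rankings A. weakly_prefers R i (f R) (f (R(i := q)))) \<longleftrightarrow>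
        \<not> (\<exists>q\<in>strict_rankings A. prefers R i (f (R(i := q))) (f R))"
      using weakly_prefers_iff_not_prefers f profiles_fun_upd[OF R i] R by metis
    also have "(\<exists>q\<in>strict_rankings A. prefers R i (f (R(i := q))) (f R)) \<longleftrightarrow>
        (\<exists>Q\<in>profiles N A. agree_outside N {i} Q R \<and> prefers R i (f Q) (f R))"
      using agree_outside_singleton_iff[OF _ R i] profiles_fun_upd[OF R i] by blast
    \<comment> \<open>For a single agent the strict improvement already implies the weak one
      required of all members.\<close>
    also have "\<dots> \<longleftrightarrow> sat (biprofile_model N A f) (R, R) (manip A {i})"
      using assms R by (auto simp: sat_manip weakly_prefers_def)
    finally show ?thesis .
  qed
  then show "strategy_proof N A f \<longleftrightarrow>
      (\<forall>R\<in>profiles N A.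
        sat (biprofile_model N A f) (R, R) (big_and N (\<lambda>i. Neg (manip A {i}))))"
    by (simp add: strategy_proof_def sat_big_and[OF assms(1)])
next
  \<comment> \<open>Finiteness gives \<open>big_and\<close> over coalitions, and the connectives
    inside each \<open>Imp\<close>, their intended reading. After \<open>sat_manip\<close> only the
    negation has to be moved through the quantifiers.\<close>
  have "finite {C. C \<noteq> {} \<and> C \<subseteq> N}"
    using assms(1) by simp
  moreover have "finite C" if "C \<subseteq> N" for C
    using assms(1) that by (rule rev_finite_subset)
  ultimately show "strongly_group_strategy_proof N A f \<longleftrightarrow>
      (\<forall>R\<in>profiles N A.
        sat (biprofile_model N A f) (R, R)
          (big_and {C. C \<noteq> {} \<and> C \<subseteq> N} (\<lambda>C. Neg (manip A C))))"
    unfolding strongly_group_strategy_proof_def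
    using sat_manip[OF assms(2) _ assms(3)] by (simp add: sat_big_and) blast
qed

end
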